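(* Let $x \in \mathbb{C}$ and define the infinite lower-triangular matrices $\widetilde{A}(x)$ and $\widetilde{B}(x)$ by $$ \widetilde{A}_{n,k}(x) = (-1)^n L_{n-k}^{(-n-1)}(-nx), \qquad \widetilde{B}_{n,k}(x) = (-1)^k \, \frac{n}{k} \, L_{n-k}^{(k-1)}(kx) $$ for $1 \leqslant k \leqslant n$. Then for any pair of complex sequences $(S_n)_{n \geqslant 1}$ and $(T_n)_{n \geqslant 1}$, the following inversion formula holds: $$ \Bigl( T_n = \sum_{k=1}^{n}\widetilde{A}_{n,k}(x)S_k \ \text{ for all } n\geqslant 1\Bigr) \Longleftrightarrow \Bigl( S_n=\sum_{k=1}^{n}\widetilde{B}_{n,k}(x)T_k \ \text{ for all } n \geqslant 1\Bigr). $$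
   Context: $L_n^{(\alpha)}$ denotes the generalized Laguerre polynomial of order $n \in \mathbb{N}$ and parameter $\alpha \in \mathbb{C}$: $L_n^{(\alpha)}(y) = \sum_{j=0}^{n} (-1)^j \binom{n+\alpha}{n-j} \frac{y^j}{j!}$, where $\binom{c}{m} = c(c-1)\cdots(c-m+1)/m!$ for $c \in \mathbb{C}$, $m \in \mathbb{N}$. *)

theory Defs
  imports Complex_Main
begin

definition laguerre :: "nat \<Rightarrow> complex \<Rightarrow> complex \<Rightarrow> complex" where
  "laguerre n \<alpha> y =
     (\<Sum>j=0..n. (-1) ^ j * ((of_nat n + \<alpha>) gchoose (n - j)) * (y ^ j / fact j))"

text \<open>Rows and columns are numbered from 1; all entries with index 0 or above the
  diagonal are set to 0.\<close>

definition A_tilde :: "complex \<Rightarrow> nat \<Rightarrow> nat \<Rightarrow> complex" where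
  "A_tilde x n k =
     (if 1 \<le> k \<and> k \<le> n
      then (-1) ^ n * laguerre (n - k) (- of_nat n - 1) (- of_nat n * x)
      else 0)"

definition B_tilde :: "complex \<Rightarrow> nat \<Rightarrow> nat \<Rightarrow> complex" where
  "B_tilde x n k =
     (if 1 \<le> k \<and> k \<le> n
      then (-1) ^ k * (of_nat n / of_nat k) * laguerre (n - k) (of_nat k - 1) (of_nat k * x)
      else 0)"

end

theory Submission
  imports Defs
begin

text \<open>
  Write \<open>E z i = z\<^sup>i / i!\<close>. After reflecting the negative upper index and absorbing the factor
  \<open>n/k\<close>, the entries become
  \<open>A n k = (\<Sum>i. (-1)\<^sup>k\<^sup>+\<^sup>i C(n-i, k) E (nx) i)\<close> and
  \<open>B k l = (-1)\<^sup>l (\<Sum>j. (l+j)/l C(k, l+j) E (-lx) j)\<close>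
  (lemmas \<open>A_tilde_binomial\<close>, \<open>B_tilde_binomial\<close>). In the product \<open>AB\<close> the inner index \<open>k\<close> now occurs
  only in \<open>(\<Sum>k. (-1)\<^sup>k C(n-i, k) C(k, l+j))\<close>, which by binomial inversion vanishes unless
  \<open>n - i = l + j\<close>. With \<open>d = n - l\<close>, what remains is, up to sign,
  \<open>(\<Sum>i+j=d. (1 + j/l) E (nx) i E (-lx) j)\<close>. By the binomial theorem the two parts of the weight
  contribute \<open>E (dx) d\<close> and \<open>-x E (dx) (d-1)\<close>. They cancel for \<open>d > 0\<close> because
  \<open>E (dx) d = x E (dx) (d-1)\<close>, so \<open>AB\<close> is the identity (lemma \<open>A_tilde_mult_B_tilde\<close>).

  This gives one implication at once. For the other, \<open>T = A S\<close> and \<open>T = A (B T)\<close> force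
  \<open>S = B T\<close>, since the triangular matrix \<open>A\<close> has diagonal entries \<open>\<plusminus>1\<close> and hence is injective
  (lemma \<open>A_tilde_cancel\<close>).
\<close>

text \<open>
  This is the orthogonality relation behind binomial inversion:
  \<open>C(N, k) C(k, M) = C(N, M) C(N-M, k-M)\<close> turns the sum into an alternating row sum of
  Pascal's triangle. The range may exceed \<open>N\<close>, so that the summation range of \<open>k\<close> need not follow
  \<open>N\<close> when sums are interchanged.
\<close>

lemma sum_alternating_binomial_product:
  fixes N M n :: nat
  assumes "N \<le> n"
  shows "(\<Sum>k\<le>n. (-1) ^ k * of_nat (N choose k) * of_nat (k choose M)) =
         (if N = M then (-1) ^ N else (0 :: 'a :: comm_ring_1))"
proof (cases "M \<le> N")
  case False
  have "(-1) ^ k * of_nat (N choose k) * of_nat (k choose M) = (0 :: 'a)" for k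
    using False by (cases "k \<le> N") (auto simp: binomial_eq_0)
  then show ?thesis using False by auto
next
  case True
  have "(\<Sum>k\<le>n. (-1) ^ k * of_nat (N choose k) * of_nat (k choose M)) =
        (\<Sum>k\<in>{M..N}. (-1) ^ k * of_nat (N choose k) * (of_nat (k choose M) :: 'a))"
    using assms by (intro sum.mono_neutral_right) (auto simp: binomial_eq_0)
  also have "\<dots> = (\<Sum>k\<in>{M..N}. (-1) ^ k * (of_nat (N choose M) * of_nat ((N - M) choose (k - M))))"
    by (intro sum.cong) (auto simp: choose_mult mult.assoc simp flip: of_nat_mult)
  also have "\<dots> = (\<Sum>i\<le>N - M. (-1) ^ (M + i) * (of_nat (N choose M) * of_nat ((N - M) choose i)))"
    using True by (intro sum.reindex_bij_witness[of _ "\<lambda>i. M + i" "\<lambda>k. k - M"]) auto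
  also have "\<dots> = (-1) ^ M * of_nat (N choose M) * (\<Sum>i\<le>N - M. (-1) ^ i * of_nat ((N - M) choose i))"
    by (simp add: sum_distrib_left power_add mult_ac)
  also have "\<dots> = (if N = M then (-1) ^ N else 0)"
    using True by (cases "N = M") (auto simp: choose_alternating_sum)
  finally show ?thesis .
qed

lemma sum_divided_powers:
  fixes a b :: "'a :: field_char_0"
  shows "(\<Sum>i\<le>d. a ^ i / fact i * (b ^ (d - i) / fact (d - i))) = (a + b) ^ d / fact d"
proof -
  have "(a + b) ^ d / fact d = (\<Sum>i\<le>d. of_nat (d choose i) * a ^ i * b ^ (d - i) / fact d)"
    by (simp add: binomial_ring sum_divide_distrib)
  also have "\<dots> = (\<Sum>i\<le>d. a ^ i / fact i * (b ^ (d - i) / fact (d - i)))"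
    by (intro sum.cong) (simp_all add: binomial_fact)
  finally show ?thesis ..
qed

text \<open>
  The weight \<open>j = Suc e - i\<close> cancels one factor of \<open>j!\<close>, that is, it applies \<open>b d/db\<close> to the
  divided power of \<open>b\<close>; this reduces the sum to the unweighted one of degree \<open>e\<close>.
\<close>

lemma sum_weighted_divided_powers:
  fixes a b :: "'a :: field_char_0"
  shows "(\<Sum>i\<le>Suc e. a ^ i / fact i * (of_nat (Suc e - i) * (b ^ (Suc e - i) / fact (Suc e - i)))) =
         b * ((a + b) ^ e / fact e)"
proof -
  have step: "of_nat (Suc m) * (b ^ Suc m / fact (Suc m)) = b * (b ^ m / fact m)" for m
    by (simp add: fact_Suc del: of_nat_Suc)
  have "(\<Sum>i\<le>Suc e. a ^ i / fact i * (of_nat (Suc e - i) * (b ^ (Suc e - i) / fact (Suc e - i)))) =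
        (\<Sum>i\<le>e. a ^ i / fact i * (b * (b ^ (e - i) / fact (e - i))))"
    unfolding sum.atMost_Suc diff_self_eq_0 of_nat_0 mult_zero_left mult_zero_right add_0_right
    by (intro sum.cong refl) (simp only: atMost_iff Suc_diff_le step)
  also have "\<dots> = b * (\<Sum>i\<le>e. a ^ i / fact i * (b ^ (e - i) / fact (e - i)))"
    by (simp add: sum_distrib_left mult_ac)
  finally show ?thesis by (simp only: sum_divided_powers)
qed

text \<open>
  The upper index of the binomial coefficients in \<open>A_tilde x n k\<close> is \<open>-(k+1)\<close>, so reflection turns
  them into ordinary ones. Both this expansion and the next are summed up to a common bound:
  the added terms vanish, and sums over different rows and columns can then be interchanged freely.
\<close>

lemma A_tilde_binomial:
  assumes "1 \<le> k" "k \<le> n"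
  shows "A_tilde x n k =
         (\<Sum>i\<le>n. (-1) ^ (k + i) * of_nat ((n - i) choose k) * ((of_nat n * x) ^ i / fact i))"
proof -
  have term_eq: "(-1) ^ n * ((-1) ^ i * ((of_nat (n - k) + (- of_nat n - 1)) gchoose (n - k - i)) *
                   ((- of_nat n * x) ^ i / fact i)) =
                 (-1) ^ (k + i) * of_nat ((n - i) choose k) * ((of_nat n * x) ^ i / fact i)"
    if i: "i \<le> n - k" for i
  proof -
    define m where "m = n - k - i"
    have n: "n = k + m + i" using assms i by (simp add: m_def)
    have "(of_nat (n - k) + (- of_nat n - 1) :: complex) = - (of_nat k + 1)"
      using assms by (simp add: of_nat_diff)
    then have "(of_nat (n - k) + (- of_nat n - 1) :: complex) gchoose m =
               (-1) ^ m * (of_nat (k + m) gchoose m)"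
      by (simp only: gbinomial_minus) simp
    also have "(of_nat (k + m) :: complex) gchoose m = of_nat ((n - i) choose k)"
      using n binomial_symmetric[of m "k + m"] by (simp flip: binomial_gbinomial del: of_nat_add)
    finally have g: "(of_nat (n - k) + (- of_nat n - 1) :: complex) gchoose m =
                     (-1) ^ m * of_nat ((n - i) choose k)" .
    have s: "(-1) ^ n * ((-1) ^ i * (-1) ^ m * (-1) ^ i) = ((-1) ^ (k + i) :: complex)"
      by (simp add: n power_add)
    have p: "(- of_nat n * x) ^ i = (-1) ^ i * (of_nat n * x) ^ i"
      by (metis mult_minus_left power_minus)
    have "(-1) ^ n * ((-1) ^ i * ((-1) ^ m * of_nat ((n - i) choose k)) *
            ((-1) ^ i * (of_nat n * x) ^ i / fact i)) =
          ((-1) ^ n * ((-1) ^ i * (-1) ^ m * (-1) ^ i)) * of_nat ((n - i) choose k) *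
            ((of_nat n * x) ^ i / fact i)"
      by (simp only: times_divide_eq_right times_divide_eq_left mult_ac)
    then show ?thesis
      by (simp only: m_def[symmetric] g p s)
  qed
  have "A_tilde x n k =
        (\<Sum>i\<in>{0..n - k}. (-1) ^ (k + i) * of_nat ((n - i) choose k) * ((of_nat n * x) ^ i / fact i))"
    using assms unfolding A_tilde_def laguerre_def sum_distrib_left
    by (simp only: simp_thms if_True) (intro sum.cong refl term_eq, simp)
  also have "\<dots> = (\<Sum>i\<le>n. (-1) ^ (k + i) * of_nat ((n - i) choose k) * ((of_nat n * x) ^ i / fact i))"
    using assms by (intro sum.mono_neutral_left) (auto simp: not_le)
  finally show ?thesis .
qed

text \<open>
  The absorption identity \<open>k C(k-1, l+j-1) = (l+j) C(k, l+j)\<close> moves the dependence on \<open>k\<close> into a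
  single binomial coefficient, the form that the orthogonality relation requires. The expansion
  also covers \<open>k < l\<close>, where both sides are zero.
\<close>

lemma B_tilde_binomial:
  assumes "1 \<le> l" "k \<le> n"
  shows "B_tilde x k l =
         (\<Sum>j\<le>n. (-1) ^ l * (of_nat (l + j) / of_nat l) * of_nat (k choose (l + j)) *
                 ((- of_nat l * x) ^ j / fact j))"
proof (cases "l \<le> k")
  case False
  then have "k choose (l + j) = 0" for j by (simp add: binomial_eq_0)
  note zero = this
  show ?thesis using False by (simp add: B_tilde_def zero)
next
  case True
  have term_eq: "(-1) ^ l * (of_nat k / of_nat l) *
                   ((-1) ^ j * ((of_nat (k - l) + (of_nat l - 1)) gchoose (k - l - j)) *
                    ((of_nat l * x) ^ j / fact j)) =
                 (-1) ^ l * (of_nat (l + j) / of_nat l) * of_nat (k choose (l + j)) *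
                   ((- of_nat l * x) ^ j / fact j)"
    if j: "j \<le> k - l" for j
  proof -
    have "(of_nat (k - l) + (of_nat l - 1) :: complex) = of_nat (k - 1)"
      using assms True by (simp add: of_nat_diff)
    moreover have "(k - 1) choose (k - l - j) = (k - 1) choose (l + j - 1)"
    proof -
      have "k - 1 - (l + j - 1) = k - l - j" using assms by simp
      then show ?thesis
        using binomial_symmetric[of "l + j - 1" "k - 1"] j True assms by simp
    qed
    ultimately have g: "(of_nat (k - l) + (of_nat l - 1) :: complex) gchoose (k - l - j) =
                        of_nat ((k - 1) choose (l + j - 1))"
      by (simp flip: binomial_gbinomial)
    have absorb: "of_nat k * of_nat ((k - 1) choose (l + j - 1)) =
                  (of_nat (l + j) * of_nat (k choose (l + j)) :: complex)"
      using times_binomial_minus1_eq[of "l + j" k] assms by (metis add_gr_0 less_le_trans of_nat_mult zero_less_one)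
    have p: "(- of_nat l * x) ^ j = (-1) ^ j * (of_nat l * x) ^ j"
      by (metis mult_minus_left power_minus)
    have "(-1) ^ l * (of_nat k / of_nat l) *
            ((-1) ^ j * of_nat ((k - 1) choose (l + j - 1)) * ((of_nat l * x) ^ j / fact j)) =
          (-1) ^ l * ((of_nat k * of_nat ((k - 1) choose (l + j - 1))) / of_nat l) *
            ((-1) ^ j * (of_nat l * x) ^ j / fact j)"
      by (simp only: times_divide_eq_right times_divide_eq_left divide_divide_eq_left mult_ac)
    then show ?thesis
      unfolding g p absorb by (simp only: times_divide_eq_right times_divide_eq_left divide_divide_eq_left mult_ac)
  qed
  have "B_tilde x k l =
        (\<Sum>j\<in>{0..k - l}. (-1) ^ l * (of_nat (l + j) / of_nat l) * of_nat (k choose (l + j)) *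
                 ((- of_nat l * x) ^ j / fact j))"
    using assms True unfolding B_tilde_def laguerre_def sum_distrib_left
    by (simp only: simp_thms if_True) (intro sum.cong refl term_eq, simp)
  also have "\<dots> = (\<Sum>j\<le>n. (-1) ^ l * (of_nat (l + j) / of_nat l) * of_nat (k choose (l + j)) *
                 ((- of_nat l * x) ^ j / fact j))"
    using assms True by (intro sum.mono_neutral_left) (auto simp: not_le)
  finally show ?thesis .
qed

text \<open>
  Orthogonality eliminates \<open>k\<close> and leaves only the pairs \<open>(i, j)\<close> with \<open>i + j = n - l\<close>. The sign then
  no longer depends on \<open>i\<close>, which makes the rest a weighted convolution of divided powers.
\<close>

lemma A_tilde_B_tilde_convolution:
  assumes l: "1 \<le> l" "l \<le> n"
  shows "(\<Sum>k=1..n. A_tilde x n k * B_tilde x k l) =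
         (\<Sum>i\<le>n - l. (-1) ^ (n + l) * (of_nat (n - i) / of_nat l) *
            ((of_nat n * x) ^ i / fact i * ((- of_nat l * x) ^ (n - l - i) / fact (n - l - i))))"
proof -
  define P where "P i = (of_nat n * x) ^ i / fact i" for i
  define Q where "Q j = (- of_nat l * x) ^ j / fact j" for j
  define c :: "nat \<Rightarrow> complex" where "c j = of_nat (l + j) / of_nat l" for j
  have "(\<Sum>k=1..n. A_tilde x n k * B_tilde x k l) =
        (\<Sum>k=1..n. (\<Sum>i\<le>n. (-1) ^ (k + i) * of_nat ((n - i) choose k) * P i) *
                   (\<Sum>j\<le>n. (-1) ^ l * c j * of_nat (k choose (l + j)) * Q j))"
    using l by (intro sum.cong refl) (simp add: A_tilde_binomial B_tilde_binomial[of l _ n] P_def Q_def c_def)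
  \<comment> \<open>The term for \<open>k = 0\<close> vanishes because \<open>l + j > 0\<close>.\<close>
  also have "\<dots> = (\<Sum>k\<le>n. (\<Sum>i\<le>n. (-1) ^ (k + i) * of_nat ((n - i) choose k) * P i) *
                   (\<Sum>j\<le>n. (-1) ^ l * c j * of_nat (k choose (l + j)) * Q j))"
    using l by (intro sum.mono_neutral_left) (auto simp: not_le binomial_eq_0)
  also have "\<dots> = (\<Sum>k\<le>n. \<Sum>i\<le>n. \<Sum>j\<le>n. (-1) ^ (i + l) * (c j * P i * Q j) *
                   ((-1) ^ k * of_nat ((n - i) choose k) * of_nat (k choose (l + j))))"
    unfolding sum_product by (intro sum.cong refl) (simp add: power_add mult_ac)
  also have "\<dots> = (\<Sum>i\<le>n. \<Sum>j\<le>n. \<Sum>k\<le>n. (-1) ^ (i + l) * (c j * P i * Q j) *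
                   ((-1) ^ k * of_nat ((n - i) choose k) * of_nat (k choose (l + j))))"
    by (rule trans[OF sum.swap], rule sum.cong[OF refl], rule sum.swap)
  also have "\<dots> = (\<Sum>i\<le>n. \<Sum>j\<le>n. (-1) ^ (i + l) * (c j * P i * Q j) *
                   (if n - i = l + j then (-1) ^ (n - i) else 0))"
    by (simp only: sum_distrib_left[symmetric] sum_alternating_binomial_product diff_le_self)
  also have "\<dots> = (\<Sum>i\<le>n. if i \<le> n - l then (-1) ^ (n + l) * (c (n - l - i) * P i * Q (n - l - i)) else 0)"
  proof (intro sum.cong refl)
    fix i assume "i \<in> {..n}"
    then have i: "i \<le> n" by simp
    have eq: "n - i = l + j \<longleftrightarrow> i \<le> n - l \<and> n - l - i = j" for j using i l by auto
    have "(-1) ^ (i + l) * (-1) ^ (n - i) = ((-1) ^ (n + l) :: complex)"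
      using i by (simp add: add.commute flip: power_add)
    then have s: "(-1) ^ (i + l) * y * (-1) ^ (n - i) = (-1) ^ (n + l) * y" for y :: complex
      by (metis mult.assoc mult.commute)
    show "(\<Sum>j\<le>n. (-1) ^ (i + l) * (c j * P i * Q j) * (if n - i = l + j then (-1) ^ (n - i) else 0)) =
          (if i \<le> n - l then (-1) ^ (n + l) * (c (n - l - i) * P i * Q (n - l - i)) else 0)"
    proof (cases "i \<le> n - l")
      case True
      have "(\<Sum>j\<le>n. (-1) ^ (i + l) * (c j * P i * Q j) * (if n - i = l + j then (-1) ^ (n - i) else 0)) =
            (\<Sum>j\<le>n. if n - l - i = j then (-1) ^ (n + l) * (c j * P i * Q j) else 0)"
        by (intro sum.cong refl) (simp add: eq True s)
      then show ?thesis using True by simp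
    qed (simp add: eq)
  qed
  also have "\<dots> = (\<Sum>i\<le>n - l. (-1) ^ (n + l) * (c (n - l - i) * P i * Q (n - l - i)))"
    by (intro sum.mono_neutral_cong_right) auto
  also have "\<dots> = (\<Sum>i\<le>n - l. (-1) ^ (n + l) * (of_nat (n - i) / of_nat l) * (P i * Q (n - l - i)))"
  proof (intro sum.cong refl)
    fix i assume "i \<in> {..n - l}"
    then have "l + (n - l - i) = n - i" using l by simp
    then show "(-1) ^ (n + l) * (c (n - l - i) * P i * Q (n - l - i)) =
               (-1) ^ (n + l) * (of_nat (n - i) / of_nat l) * (P i * Q (n - l - i))"
      by (simp only: c_def mult.assoc)
  qed
  finally show ?thesis unfolding P_def Q_def .
qed

text \<open>
  Off the diagonal, the weight \<open>(n - i)/l = 1 + (n - l - i)/l\<close> splits the convolution into the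
  unweighted and the weighted sum of divided powers, and these cancel because the arguments
  \<open>nx\<close> and \<open>-lx\<close> add up to \<open>(n - l)x\<close>.
\<close>

lemma A_tilde_mult_B_tilde:
  assumes l: "1 \<le> l" "l \<le> n"
  shows "(\<Sum>k=1..n. A_tilde x n k * B_tilde x k l) = (if n = l then 1 else 0)"
proof (cases "n = l")
  case True
  then show ?thesis
    using l by (simp add: A_tilde_B_tilde_convolution del: One_nat_def)
next
  case False
  then obtain e where e: "n - l = Suc e" using l by (metis Suc_diff_Suc le_neq_implies_less)
  then have n: "n = l + Suc e" by simp
  define a b where "a = of_nat n * x" and "b = - of_nat l * x"
  define F where "F i = a ^ i / fact i * (b ^ (Suc e - i) / fact (Suc e - i))" for i
  have ab: "a + b = of_nat (Suc e) * x" by (simp add: a_def b_def n algebra_simps)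
  have "(\<Sum>k=1..n. A_tilde x n k * B_tilde x k l) =
        (\<Sum>i\<le>Suc e. (-1) ^ (n + l) * (of_nat (n - i) / of_nat l) * F i)"
    using A_tilde_B_tilde_convolution[OF l, of x] unfolding e F_def a_def b_def .
  also have "\<dots> = (\<Sum>i\<le>Suc e. (-1) ^ (n + l) * (F i + of_nat (Suc e - i) * F i / of_nat l))"
  proof (intro sum.cong refl)
    fix i assume "i \<in> {..Suc e}"
    then have "n - i = l + (Suc e - i)" by (simp add: n)
    then have "of_nat (n - i) / of_nat l = (1 + of_nat (Suc e - i) / of_nat l :: complex)"
      using l by (simp add: add_divide_distrib)
    then show "(-1) ^ (n + l) * (of_nat (n - i) / of_nat l) * F i =
               (-1) ^ (n + l) * (F i + of_nat (Suc e - i) * F i / of_nat l)"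
      by (simp only: distrib_right distrib_left mult_1_left times_divide_eq_left mult.assoc)
  qed
  also have "\<dots> = (-1) ^ (n + l) * ((\<Sum>i\<le>Suc e. F i) + (\<Sum>i\<le>Suc e. of_nat (Suc e - i) * F i) / of_nat l)"
    by (simp only: sum_distrib_left[symmetric] sum.distrib sum_divide_distrib)
  also have "(\<Sum>i\<le>Suc e. F i) = (a + b) ^ Suc e / fact (Suc e)"
    unfolding F_def by (rule sum_divided_powers)
  also have "(\<Sum>i\<le>Suc e. of_nat (Suc e - i) * F i) = b * ((a + b) ^ e / fact e)"
    unfolding F_def sum_weighted_divided_powers[of a e b, symmetric]
    by (simp only: mult.left_commute)
  also have "(a + b) ^ Suc e / fact (Suc e) = x * ((a + b) ^ e / fact e)"
    by (simp add: ab fact_Suc del: of_nat_Suc)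
  also have "x * ((a + b) ^ e / fact e) + b * ((a + b) ^ e / fact e) / of_nat l = 0"
    using l by (simp add: b_def)
  finally show ?thesis using False by simp
qed

lemma A_tilde_diagonal: "1 \<le> n \<Longrightarrow> A_tilde x n n = (-1) ^ n"
  by (simp add: A_tilde_def laguerre_def)

lemma A_tilde_apply_B_tilde:
  assumes "1 \<le> n"
  shows "(\<Sum>k=1..n. A_tilde x n k * (\<Sum>l=1..k. B_tilde x k l * T l)) = T n"
proof -
  have "(\<Sum>k=1..n. A_tilde x n k * (\<Sum>l=1..k. B_tilde x k l * T l)) =
        (\<Sum>k=1..n. A_tilde x n k * (\<Sum>l=1..n. B_tilde x k l * T l))"
    by (intro sum.cong refl arg_cong2[of _ _ _ _ "(*)"] sum.mono_neutral_left) (auto simp: B_tilde_def)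
  also have "\<dots> = (\<Sum>l=1..n. (\<Sum>k=1..n. A_tilde x n k * B_tilde x k l) * T l)"
    unfolding sum_distrib_left sum_distrib_right by (subst sum.swap) (simp add: mult.assoc)
  also have "\<dots> = (\<Sum>l=1..n. if n = l then T l else 0)"
    by (intro sum.cong) (auto simp: A_tilde_mult_B_tilde simp del: One_nat_def)
  also have "\<dots> = T n" using assms by simp
  finally show ?thesis .
qed

lemma A_tilde_cancel:
  assumes eq: "\<And>n. 1 \<le> n \<Longrightarrow> (\<Sum>k=1..n. A_tilde x n k * U k) = (\<Sum>k=1..n. A_tilde x n k * V k)"
    and "1 \<le> n"
  shows "U n = V n"
  using \<open>1 \<le> n\<close>
proof (induction n rule: less_induct)
  case (less n)
  have "{1..n} = insert n {1..<n}" using less.prems by auto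
  then have "A_tilde x n n * U n + (\<Sum>k\<in>{1..<n}. A_tilde x n k * U k) =
             A_tilde x n n * V n + (\<Sum>k\<in>{1..<n}. A_tilde x n k * V k)"
    using eq[OF less.prems] by simp
  moreover have "(\<Sum>k\<in>{1..<n}. A_tilde x n k * U k) = (\<Sum>k\<in>{1..<n}. A_tilde x n k * V k)"
    using less.IH by (intro sum.cong) auto
  ultimately show ?case using less.prems by (simp add: A_tilde_diagonal)
qed

theorem corollary4p5:
  fixes x :: complex and S T :: "nat \<Rightarrow> complex"
  shows "(\<forall>n\<ge>1. T n = (\<Sum>k=1..n. A_tilde x n k * S k)) \<longleftrightarrow>
         (\<forall>n\<ge>1. S n = (\<Sum>k=1..n. B_tilde x n k * T k))"
proof
  assume T: "\<forall>n\<ge>1. T n = (\<Sum>k=1..n. A_tilde x n k * S k)"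
  show "\<forall>n\<ge>1. S n = (\<Sum>k=1..n. B_tilde x n k * T k)"
  proof (intro allI impI, rule A_tilde_cancel)
    fix m :: nat
    assume "1 \<le> m"
    then show "(\<Sum>k=1..m. A_tilde x m k * S k) =
               (\<Sum>k=1..m. A_tilde x m k * (\<Sum>l=1..k. B_tilde x k l * T l))"
      using T by (simp only: A_tilde_apply_B_tilde)
  qed
next
  assume S: "\<forall>n\<ge>1. S n = (\<Sum>k=1..n. B_tilde x n k * T k)"
  show "\<forall>n\<ge>1. T n = (\<Sum>k=1..n. A_tilde x n k * S k)"
  proof (intro allI impI)
    fix n :: nat
    assume n: "1 \<le> n"
    have "(\<Sum>k=1..n. A_tilde x n k * S k) =
          (\<Sum>k=1..n. A_tilde x n k * (\<Sum>l=1..k. B_tilde x k l * T l))"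
      using S by (intro sum.cong) auto
    then show "T n = (\<Sum>k=1..n. A_tilde x n k * S k)"
      using A_tilde_apply_B_tilde[OF n] by simp
  qed
qed

end
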